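(* Let $H$ be a Hilbert space and let $M\subseteq\mathcal{L}(H)$ be a ternary ring of operators. If $A=MM^*$ and $B=M^*M$ are commutative $C^*$-algebras, then $M$ is locally regular.
   Context: Products of sets of operators (and of an operator with a set), such as $XY$ or $uX$, denote closed linear spans of all products. A ternary ring of operators is a closed subspace $M\subseteq\mathcal{L}(H)$ with $MM^*M\subseteq M$ ($\mathcal{L}(H)$ is the algebra of bounded operators). It is regular if there is $u\in\mathcal{L}(H)$ with $M^*u=M^*M$, $uM^*=MM^*$, $uu^*M=M$ and $Mu^*u=M$. An ideal of $M$ is a closed subspace $N\subseteq M$ with $NM^*M\subseteq N$ and $MM^*N\subseteq N$. $M$ is locally regular if there is a family $\{M_i\}_{i\in I}$ of ideals of $M$, each a regular ternary ring of operators, with $M=\overline{\sum_{i\in I}M_i}$. *)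

theory Defs
  imports "HOL-Analysis.Analysis"
begin

section \<open>Complex Hilbert spaces\<close>

class complex_vector = real_vector +
  fixes scaleC :: "complex \<Rightarrow> 'a \<Rightarrow> 'a"  (infixr \<open>*\<^sub>C\<close> 75)
  assumes scaleC_add_right: "c *\<^sub>C (x + y) = c *\<^sub>C x + c *\<^sub>C y"
    and scaleC_add_left: "(c + d) *\<^sub>C x = c *\<^sub>C x + d *\<^sub>C x"
    and scaleC_scaleC: "c *\<^sub>C d *\<^sub>C x = (c * d) *\<^sub>C x"
    and scaleC_of_real: "complex_of_real r *\<^sub>C x = r *\<^sub>R x"

lemma scaleC_one: "1 *\<^sub>C (x :: 'a :: complex_vector) = x"
  using scaleC_of_real[of 1 x] by simp

global_interpretation complex_vector:
  vector_space "scaleC :: complex \<Rightarrow> 'a \<Rightarrow> 'a :: complex_vector"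
  by unfold_locales (simp_all add: scaleC_add_right scaleC_add_left scaleC_scaleC scaleC_one)

class complex_normed_vector = complex_vector + real_normed_vector +
  assumes norm_scaleC: "norm (c *\<^sub>C x) = cmod c * norm x"

text \<open>The inner product is conjugate-linear in its first argument.\<close>

class complex_inner = complex_normed_vector +
  fixes cinner :: "'a \<Rightarrow> 'a \<Rightarrow> complex"
  assumes cinner_commute: "cinner x y = cnj (cinner y x)"
    and cinner_add_left: "cinner (x + y) z = cinner x z + cinner y z"
    and cinner_scaleC_left: "cinner (c *\<^sub>C x) y = cnj c * cinner x y"
    and cinner_ge_zero: "0 \<le> Re (cinner x x)"
    and cinner_eq_zero_iff: "cinner x x = 0 \<longleftrightarrow> x = 0"
    and norm_eq_sqrt_cinner: "norm x = sqrt (Re (cinner x x))"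

class chilbert_space = complex_inner + complete_space

instantiation complex :: chilbert_space
begin

definition scaleC_complex :: "complex \<Rightarrow> complex \<Rightarrow> complex" where
  "scaleC_complex c x = c * x"

definition cinner_complex :: "complex \<Rightarrow> complex \<Rightarrow> complex" where
  "cinner_complex x y = cnj x * y"

instance
proof
  fix x :: complex
  have "Re (cnj x * x) = (cmod x)\<^sup>2"
    unfolding cmod_power2 by (simp add: power2_eq_square)
  then show "norm x = sqrt (Re (cinner x x))"
    by (simp add: cinner_complex_def)
qed (simp_all add: scaleC_complex_def cinner_complex_def algebra_simps norm_mult scaleR_conv_of_real)

end


section \<open>Bounded operators\<close>

instantiation blinfun :: (real_normed_vector, complex_normed_vector) complex_vector
begin

lift_definition scaleC_blinfun :: "complex \<Rightarrow> 'a \<Rightarrow>\<^sub>L 'b \<Rightarrow> 'a \<Rightarrow>\<^sub>L 'b"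
  is "\<lambda>c f x. c *\<^sub>C f x"
proof -
  fix c :: complex and f :: "'a \<Rightarrow> 'b"
  assume f: "bounded_linear f"
  have scale: "c *\<^sub>C r *\<^sub>R y = r *\<^sub>R c *\<^sub>C y" for r and y :: 'b
    by (simp add: scaleC_of_real[symmetric] scaleC_scaleC mult.commute)
  have "bounded_linear (\<lambda>y :: 'b. c *\<^sub>C y)"
    by (rule bounded_linear_intro[where K = "cmod c"])
      (simp_all add: scaleC_add_right scale norm_scaleC mult.commute)
  then show "bounded_linear (\<lambda>x. c *\<^sub>C f x)"
    by (rule bounded_linear_compose) (rule f)
qed

instance
  by standard
    (transfer, simp add: scaleC_add_right scaleC_add_left scaleC_scaleC scaleC_of_real fun_eq_iff)+

end

text \<open>
  The type \<open>'a \<Rightarrow>\<^sub>L 'a\<close> consists of the bounded real-linear maps. The algebra \<open>\<L>(H)\<close> is its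
  norm-closed subset of complex-linear maps, with the operator norm inherited from that type.
\<close>

definition bounded_ops :: "('a :: chilbert_space \<Rightarrow>\<^sub>L 'a) set" where
  "bounded_ops = {T. \<forall>c x. blinfun_apply T (c *\<^sub>C x) = c *\<^sub>C blinfun_apply T x}"

text \<open>Meaningful for \<open>T \<in> bounded_ops\<close>, where the Riesz theorem provides existence.\<close>

definition op_adj :: "('a :: chilbert_space \<Rightarrow>\<^sub>L 'a) \<Rightarrow> 'a \<Rightarrow>\<^sub>L 'a" where
  "op_adj T = (THE S. S \<in> bounded_ops \<and>
     (\<forall>x y. cinner (blinfun_apply T x) y = cinner x (blinfun_apply S y)))"

definition closed_csubspace :: "('a :: chilbert_space \<Rightarrow>\<^sub>L 'a) set \<Rightarrow> bool" where
  "closed_csubspace X \<longleftrightarrow> X \<subseteq> bounded_ops \<and> complex_vector.subspace X \<and> closed X"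

text \<open>
  Closed linear span of all products. An operator \<open>u\<close> takes part in a product as \<open>{u}\<close>, and
  longer products are iterated; the inner closures do not affect the final closed span.
\<close>

definition op_prod ::
  "('a :: chilbert_space \<Rightarrow>\<^sub>L 'a) set \<Rightarrow> ('a \<Rightarrow>\<^sub>L 'a) set \<Rightarrow> ('a \<Rightarrow>\<^sub>L 'a) set"  (infixl \<open>\<odot>\<close> 70) where
  "X \<odot> Y = closure (complex_vector.span {x o\<^sub>L y | x y. x \<in> X \<and> y \<in> Y})"

definition commutative_cstar_algebra :: "('a :: chilbert_space \<Rightarrow>\<^sub>L 'a) set \<Rightarrow> bool" where
  "commutative_cstar_algebra A \<longleftrightarrow>
     closed_csubspace A \<and>
     (\<forall>a\<in>A. \<forall>b\<in>A. a o\<^sub>L b \<in> A) \<and>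
     (\<forall>a\<in>A. op_adj a \<in> A) \<and>
     (\<forall>a\<in>A. \<forall>b\<in>A. a o\<^sub>L b = b o\<^sub>L a)"


section \<open>Ternary rings of operators\<close>

definition tro :: "('a :: chilbert_space \<Rightarrow>\<^sub>L 'a) set \<Rightarrow> bool" where
  "tro M \<longleftrightarrow> closed_csubspace M \<and> M \<odot> op_adj ` M \<odot> M \<subseteq> M"

definition regular_tro :: "('a :: chilbert_space \<Rightarrow>\<^sub>L 'a) set \<Rightarrow> bool" where
  "regular_tro M \<longleftrightarrow> tro M \<and>
     (\<exists>u\<in>bounded_ops.
        op_adj ` M \<odot> {u} = op_adj ` M \<odot> M \<and>
        {u} \<odot> op_adj ` M = M \<odot> op_adj ` M \<and>
        {u} \<odot> {op_adj u} \<odot> M = M \<and>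
        M \<odot> {op_adj u} \<odot> {u} = M)"

definition tro_ideal :: "('a :: chilbert_space \<Rightarrow>\<^sub>L 'a) set \<Rightarrow> ('a \<Rightarrow>\<^sub>L 'a) set \<Rightarrow> bool" where
  "tro_ideal N M \<longleftrightarrow>
     closed_csubspace N \<and> N \<subseteq> M \<and>
     N \<odot> op_adj ` M \<odot> M \<subseteq> N \<and>
     M \<odot> op_adj ` M \<odot> N \<subseteq> N"

text \<open>The algebraic sum of a (possibly infinite) family: all finite sums of members.\<close>

definition family_sum :: "'i set \<Rightarrow> ('i \<Rightarrow> 'v :: ab_group_add set) \<Rightarrow> 'v set" where
  "family_sum I X = {\<Sum>i\<in>J. x i | J x. finite J \<and> J \<subseteq> I \<and> (\<forall>i\<in>J. x i \<in> X i)}"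

text \<open>
  The family of ideals is indexed by a set of subsets of \<open>\<L>(H)\<close>; any family can be reindexed
  in this way by its set of members without changing the sum.
\<close>

definition locally_regular :: "('a :: chilbert_space \<Rightarrow>\<^sub>L 'a) set \<Rightarrow> bool" where
  "locally_regular M \<longleftrightarrow>
     (\<exists>(I :: ('a \<Rightarrow>\<^sub>L 'a) set set) X.
        (\<forall>i\<in>I. tro_ideal (X i) M \<and> regular_tro (X i)) \<and>
        M = closure (family_sum I X))"

end

theory Submission
  imports Defs
begin

text \<open>
  If \<open>M M\<^sup>*\<close> and \<open>M\<^sup>* M\<close> are commutative, then \<open>M\<close> behaves like the space of sections, vanishing
  at infinity, of a hermitian line bundle over a locally compact space, with \<open>x y\<^sup>* z\<close> the pointwise product. On the open set where a fixed
  section \<open>m\<close> does not vanish, \<open>m\<close> trivialises the bundle, and the sections supported there form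
  an ideal that is regular with \<open>u = m\<close>. These open sets cover the base.

  The proof below carries this out without spectra. The one-dimensionality of the fibres is the
  symmetry \<open>x y\<^sup>* z = z y\<^sup>* x\<close> (lemma \<open>triple_symmetric\<close>): the difference \<open>D\<close> of the two sides
  satisfies \<open>D y\<^sup>* = 0\<close>, since elements of \<open>M M\<^sup>*\<close> commute, and then \<open>(D\<^sup>* D)\<^sup>2 = 0\<close>, since elements
  of \<open>M\<^sup>* M\<close> commute as well. The ideal belonging to \<open>m\<close> is the closure of \<open>m m\<^sup>* M\<close>. It contains \<open>m\<close>,
  because \<open>(1 - t m m\<^sup>*)\<^sup>n m\<close> tends to \<open>0\<close> for small \<open>t > 0\<close> and differs from \<open>m\<close> by an element of
  \<open>m m\<^sup>* M\<close>; a telescoping sum proves this convergence without functional calculus. Once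
  \<open>m\<close> lies in its ideal, all four equations of regularity for \<open>u = m\<close> are rearrangements of
  triple products by the symmetry, and every \<open>m \<in> M\<close> lies in one of the ideals, so they exhaust \<open>M\<close>.
\<close>

section \<open>Inner products and the Riesz theorem\<close>

lemma cinner_add_right: "cinner x (y + z) = cinner x y + cinner x (z :: 'a :: complex_inner)"
proof -
  have "cinner x (y + z) = cnj (cinner (y + z) x)"
    by (rule cinner_commute)
  also have "\<dots> = cnj (cinner y x) + cnj (cinner z x)"
    by (simp add: cinner_add_left)
  finally show ?thesis
    by (simp flip: cinner_commute)
qed

lemma cinner_scaleC_right: "cinner x (c *\<^sub>C y) = c * cinner x (y :: 'a :: complex_inner)"
proof -
  have "cinner x (c *\<^sub>C y) = cnj (cinner (c *\<^sub>C y) x)"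
    by (rule cinner_commute)
  also have "\<dots> = c * cnj (cinner y x)"
    by (simp add: cinner_scaleC_left)
  finally show ?thesis
    by (simp flip: cinner_commute)
qed

lemma cinner_scaleR_left: "cinner (r *\<^sub>R x) y = of_real r * cinner x (y :: 'a :: complex_inner)"
  by (simp flip: scaleC_of_real add: cinner_scaleC_left)

lemma cinner_scaleR_right: "cinner x (r *\<^sub>R y) = of_real r * cinner x (y :: 'a :: complex_inner)"
  by (simp flip: scaleC_of_real add: cinner_scaleC_right)

lemma cinner_diff_left: "cinner (x - y) z = cinner x z - cinner y (z :: 'a :: complex_inner)"
  using cinner_add_left[of "x - y" y z] by simp

lemma cinner_diff_right: "cinner x (y - z) = cinner x y - cinner x (z :: 'a :: complex_inner)"
  using cinner_add_right[of x "y - z" z] by simp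

lemma norm_sq_eq_cinner: "(norm x)\<^sup>2 = Re (cinner x (x :: 'a :: complex_inner))"
  by (simp add: norm_eq_sqrt_cinner cinner_ge_zero)

lemma Re_cinner_commute: "Re (cinner x y) = Re (cinner y (x :: 'a :: complex_inner))"
  by (subst cinner_commute) simp

lemma norm_sq_add:
  "(norm (x + y))\<^sup>2 = (norm x)\<^sup>2 + 2 * Re (cinner x y) + (norm (y :: 'a :: complex_inner))\<^sup>2"
  by (simp add: norm_sq_eq_cinner cinner_add_left cinner_add_right Re_cinner_commute[of y x])

lemma norm_sq_diff:
  "(norm (x - y))\<^sup>2 = (norm x)\<^sup>2 - 2 * Re (cinner x y) + (norm (y :: 'a :: complex_inner))\<^sup>2"
  by (simp add: norm_sq_eq_cinner cinner_diff_left cinner_diff_right Re_cinner_commute[of y x])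

text \<open>The triangle inequality is part of the class, and squaring it gives Cauchy-Schwarz.\<close>

lemma Re_cinner_le: "Re (cinner x y) \<le> norm x * norm (y :: 'a :: complex_inner)"
proof -
  have "(norm (x + y))\<^sup>2 \<le> (norm x + norm y)\<^sup>2"
    by (intro power_mono norm_triangle_ineq) simp
  then show ?thesis
    by (simp add: norm_sq_add power2_sum)
qed

lemma abs_Re_cinner_le: "\<bar>Re (cinner x y)\<bar> \<le> norm x * norm (y :: 'a :: complex_inner)"
  using Re_cinner_le[of x y] Re_cinner_le[of "- x" y] cinner_diff_left[of 0 x y]
    cinner_diff_left[of x x y] by (simp add: abs_le_iff)

lemma cinner_left_imp_eq:
  assumes "\<And>x. cinner x v = cinner x (w :: 'a :: complex_inner)"
  shows "v = w"
  using assms[of "v - w"] cinner_eq_zero_iff[of "v - w"] by (simp add: cinner_diff_right)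

text \<open>If real parts agree for all \<open>x\<close>, then so do imaginary parts, by passing from \<open>x\<close> to \<open>\<i> x\<close>.\<close>

lemma conj_linear_eq_if_Re_eq:
  fixes g h :: "'a :: complex_vector \<Rightarrow> complex"
  assumes "\<And>c x. g (c *\<^sub>C x) = cnj c * g x" "\<And>c x. h (c *\<^sub>C x) = cnj c * h x"
    and "\<And>x. Re (g x) = Re (h x)"
  shows "g x = h x"
  using assms(3)[of x] assms(3)[of "\<i> *\<^sub>C x"] by (simp add: assms(1,2) complex_eq_iff)

text \<open>
  The vector representing \<open>f\<close> is the minimiser of \<open>J x = \<parallel>x\<parallel>\<^sup>2 - 2 f x\<close>. By the parallelogram law,
  minimising sequences of \<open>J\<close> are Cauchy.
\<close>

lemma riesz_real:
  fixes f :: "'a :: chilbert_space \<Rightarrow> real"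
  assumes f: "bounded_linear f"
  shows "\<exists>v. \<forall>x. f x = Re (cinner x v)"
proof -
  interpret f: bounded_linear f by (rule f)
  define J where "J x = (norm x)\<^sup>2 - 2 * f x" for x
  obtain K where K: "\<And>x. norm (f x) \<le> norm x * K"
    using f.bounded by blast
  have J_ge: "J x \<ge> - K\<^sup>2" for x
  proof -
    have "f x \<le> norm x * K"
      using K[of x] by simp
    moreover have "0 \<le> (norm x - K)\<^sup>2"
      by simp
    ultimately show ?thesis
      by (simp add: J_def power2_diff)
  qed
  have bdd: "bdd_below (range J)"
    using J_ge by (auto intro!: bdd_belowI2[where m = "- K\<^sup>2"])
  define m where "m = Inf (range J)"
  have m_le: "m \<le> J x" for x
    unfolding m_def by (intro cInf_lower bdd) simp
  have "\<exists>x. J x < m + 1 / real (Suc n)" for n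
    using cInf_lessD[of "range J" "m + 1 / real (Suc n)"] by (auto simp: m_def)
  then obtain X where X: "\<And>n. J (X n) < m + 1 / real (Suc n)"
    by metis
  have dist_sq: "(dist x y)\<^sup>2 \<le> 2 * J x + 2 * J y - 4 * m" for x y
  proof -
    have "(norm (x - y))\<^sup>2 = 2 * J x + 2 * J y - 4 * J ((1/2) *\<^sub>R (x + y))"
      by (simp add: J_def f.scaleR f.add power_mult_distrib norm_sq_add norm_sq_diff power_divide
          cinner_scaleR_left cinner_scaleR_right field_simps)
    with m_le[of "(1/2) *\<^sub>R (x + y)"] show ?thesis
      by (simp add: dist_norm)
  qed
  have "Cauchy X"
  proof (rule metric_CauchyI)
    fix e :: real
    assume "0 < e"
    then obtain N where N: "4 / real (Suc N) < e\<^sup>2"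
      using reals_Archimedean[of "e\<^sup>2 / 4"] by (auto simp: field_simps)
    have "dist (X i) (X j) < e" if "i \<ge> N" "j \<ge> N" for i j
    proof -
      have "1 / real (Suc i) \<le> 1 / real (Suc N)" "1 / real (Suc j) \<le> 1 / real (Suc N)"
        using that by (auto intro!: divide_left_mono)
      then have "(dist (X i) (X j))\<^sup>2 < e\<^sup>2"
        using dist_sq[of "X i" "X j"] X[of i] X[of j] N by simp
      then show ?thesis
        using \<open>0 < e\<close> by (simp add: power2_less_imp_less)
    qed
    then show "\<exists>N. \<forall>i\<ge>N. \<forall>j\<ge>N. dist (X i) (X j) < e"
      by blast
  qed
  then obtain v where v: "X \<longlonglongrightarrow> v"
    using Cauchy_convergent convergent_def by blast
  have "J v \<le> m"
  proof (rule LIMSEQ_le)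
    show "(\<lambda>n. J (X n)) \<longlonglongrightarrow> J v"
      unfolding J_def by (intro tendsto_intros v f.tendsto)
    show "(\<lambda>n. m + 1 / real (Suc n)) \<longlonglongrightarrow> m"
      using tendsto_add[OF tendsto_const[of m] LIMSEQ_inverse_real_of_nat] by (simp add: field_simps)
  qed (use X in \<open>auto intro: less_imp_le\<close>)
  then have min: "J v \<le> J x" for x
    using m_le order_trans by blast
  have "f x = Re (cinner x v)" for x
  proof -
    define c where "c = Re (cinner x v) - f x"
    define q where "q = (norm x)\<^sup>2 + 1"
    have q: "q > 0"
      by (simp add: q_def add_nonneg_pos)
    have norm_x: "(norm x)\<^sup>2 = q - 1"
      by (simp add: q_def)
    have "0 \<le> 2 * s * c + s\<^sup>2 * (norm x)\<^sup>2" for s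
      using min[of "v + s *\<^sub>R x"]
      by (simp add: J_def norm_sq_add cinner_scaleR_right f.add f.scaleR c_def
          Re_cinner_commute[of v x] power_mult_distrib algebra_simps)
    \<comment> \<open>The linear term dominates for small \<open>s\<close>; for this \<open>s\<close> the bound is negative unless \<open>c = 0\<close>.\<close>
    from this[of "- c / q"] have "0 \<le> q\<^sup>2 * (2 * (- c / q) * c + (- c / q)\<^sup>2 * (norm x)\<^sup>2)"
      by simp
    also have "\<dots> = - (c\<^sup>2 * (q + 1))"
      unfolding norm_x using q by (simp add: field_simps power2_eq_square)
    finally have "c\<^sup>2 * (q + 1) \<le> 0"
      by simp
    then have "c = 0"
      using q by (simp add: mult_le_0_iff)
    then show ?thesis
      by (simp add: c_def)
  qed
  then show ?thesis
    by blast
qed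

section \<open>Adjoints\<close>

lemma bounded_ops_scaleC: "T \<in> bounded_ops \<Longrightarrow> T (c *\<^sub>C x) = c *\<^sub>C T x"
  by (simp add: bounded_ops_def)

lemma bounded_ops_compose: "S \<in> bounded_ops \<Longrightarrow> T \<in> bounded_ops \<Longrightarrow> S o\<^sub>L T \<in> bounded_ops"
  by (simp add: bounded_ops_def)

lemma adjoint_exists:
  assumes T: "T \<in> bounded_ops"
  shows "\<exists>S\<in>bounded_ops. \<forall>x y. cinner (T x) y = cinner x (blinfun_apply S y)"
proof -
  have "\<exists>v. \<forall>x. cinner (T x) y = cinner x v" for y
  proof -
    have "bounded_linear (\<lambda>x. Re (cinner (T x) y))"
    proof (rule bounded_linear_intro[where K = "norm T * norm y"])
      fix x
      have "norm (Re (cinner (T x) y)) \<le> norm (T x) * norm y"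
        by (simp add: abs_Re_cinner_le)
      also have "\<dots> \<le> (norm T * norm x) * norm y"
        by (intro mult_right_mono norm_blinfun) simp
      finally show "norm (Re (cinner (T x) y)) \<le> norm x * (norm T * norm y)"
        by (simp add: ac_simps)
    qed (simp_all add: blinfun.bilinear_simps cinner_add_left cinner_scaleR_left)
    then obtain v where v: "\<And>x. Re (cinner (T x) y) = Re (cinner x v)"
      using riesz_real by blast
    have "cinner (T x) y = cinner x v" for x
      by (rule conj_linear_eq_if_Re_eq[of "\<lambda>x. cinner (T x) y" "\<lambda>x. cinner x v"])
        (simp_all add: bounded_ops_scaleC[OF T] cinner_scaleC_left v)
    then show ?thesis
      by blast
  qed
  then obtain F where F: "\<And>x y. cinner (T x) y = cinner x (F y)"
    by metis
  have F_scaleC: "F (c *\<^sub>C y) = c *\<^sub>C F y" for c y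
    by (rule cinner_left_imp_eq) (simp add: cinner_scaleC_right flip: F)
  have "norm (F y) \<le> norm y * norm T" for y
  proof (cases "F y = 0")
    case False
    have "norm (F y) * norm (F y) = Re (cinner (T (F y)) y)"
      by (simp add: F norm_sq_eq_cinner flip: power2_eq_square)
    also have "\<dots> \<le> norm (T (F y)) * norm y"
      by (rule Re_cinner_le)
    also have "\<dots> \<le> (norm T * norm (F y)) * norm y"
      by (intro mult_right_mono norm_blinfun) simp
    finally have "norm (F y) * norm (F y) \<le> norm (F y) * (norm y * norm T)"
      by (simp add: ac_simps)
    with False show ?thesis
      by simp
  qed simp
  then have F_bounded: "bounded_linear F"
  proof (intro bounded_linear_intro)
    show "F (x + y) = F x + F y" for x y
      by (rule cinner_left_imp_eq) (simp add: cinner_add_right flip: F)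
    show "F (r *\<^sub>R x) = r *\<^sub>R F x" for r x
      by (simp add: F_scaleC flip: scaleC_of_real)
  qed
  show ?thesis
    by (rule bexI[where x = "Blinfun F"])
      (simp_all add: F bounded_ops_def bounded_linear_Blinfun_apply[OF F_bounded] F_scaleC)
qed

lemma op_adj_eqI:
  fixes S T :: "'a :: chilbert_space \<Rightarrow>\<^sub>L 'a"
  assumes S: "S \<in> bounded_ops" "\<And>x y. cinner (T x) y = cinner x (blinfun_apply S y)"
  shows "op_adj T = S"
  unfolding op_adj_def
proof (rule the_equality)
  fix S' assume S': "S' \<in> bounded_ops \<and> (\<forall>x y. cinner (T x) y = cinner x (blinfun_apply S' y))"
  show "S' = S"
  proof (rule blinfun_eqI, rule cinner_left_imp_eq)
    show "cinner x (S' y) = cinner x (S y)" for x y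
      using S' S(2) by metis
  qed
qed (use S in auto)

lemma
  assumes "T \<in> bounded_ops"
  shows op_adj_in: "op_adj T \<in> bounded_ops"
    and cinner_op_adj: "cinner (T x) y = cinner x (op_adj T y)"
proof -
  obtain S where S: "S \<in> bounded_ops" "\<And>x y. cinner (T x) y = cinner x (blinfun_apply S y)"
    using adjoint_exists[OF assms] by blast
  have "op_adj T = S"
    using S by (rule op_adj_eqI)
  with S show "op_adj T \<in> bounded_ops" "cinner (T x) y = cinner x (op_adj T y)"
    by simp_all
qed

lemma cinner_op_adj_left:
  assumes "T \<in> bounded_ops"
  shows "cinner (op_adj T x) y = cinner x (T y)"
proof -
  have "cinner (op_adj T x) y = cnj (cinner y (op_adj T x))"
    by (rule cinner_commute)
  also have "\<dots> = cnj (cinner (T y) x)"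
    by (simp add: cinner_op_adj[OF assms])
  finally show ?thesis
    by (simp flip: cinner_commute)
qed

lemma op_adj_op_adj: "T \<in> bounded_ops \<Longrightarrow> op_adj (op_adj T) = T"
  by (rule op_adj_eqI) (simp_all add: cinner_op_adj_left)

lemma op_adj_compose:
  "S \<in> bounded_ops \<Longrightarrow> T \<in> bounded_ops \<Longrightarrow> op_adj (S o\<^sub>L T) = op_adj T o\<^sub>L op_adj S"
  by (rule op_adj_eqI) (simp_all add: bounded_ops_compose op_adj_in cinner_op_adj)

lemma blinfun_compose_assoc: "(a o\<^sub>L b) o\<^sub>L c = a o\<^sub>L (b o\<^sub>L c)"
  by (rule blinfun_eqI) simp

lemma op_adj_triple:
  assumes "x \<in> bounded_ops" "y \<in> bounded_ops" "z \<in> bounded_ops"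
  shows "op_adj (x o\<^sub>L op_adj y o\<^sub>L z) = op_adj z o\<^sub>L y o\<^sub>L op_adj x"
  using assms
  by (simp add: op_adj_compose op_adj_op_adj op_adj_in bounded_ops_compose blinfun_compose_assoc)

lemma norm_op_adj_le:
  assumes T: "T \<in> bounded_ops"
  shows "norm (op_adj T) \<le> norm T"
proof (rule norm_blinfun_bound)
  fix y
  show "norm (op_adj T y) \<le> norm T * norm y"
  proof (cases "op_adj T y = 0")
    case False
    have "norm (op_adj T y) * norm (op_adj T y) = Re (cinner (T (op_adj T y)) y)"
      by (simp add: cinner_op_adj[OF T] norm_sq_eq_cinner flip: power2_eq_square)
    also have "\<dots> \<le> norm (T (op_adj T y)) * norm y"
      by (rule Re_cinner_le)
    also have "\<dots> \<le> (norm T * norm (op_adj T y)) * norm y"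
      by (intro mult_right_mono norm_blinfun) simp
    finally have "norm (op_adj T y) * norm (op_adj T y) \<le> norm (op_adj T y) * (norm T * norm y)"
      by (simp add: ac_simps)
    with False show ?thesis
      by simp
  qed simp
qed simp

lemma op_adj_compose_self_eq_0:
  assumes T: "T \<in> bounded_ops" and "op_adj T o\<^sub>L T = 0"
  shows "T = 0"
proof (rule blinfun_eqI)
  fix x
  have "op_adj T (T x) = 0"
    using assms(2) by (simp flip: blinfun_apply_blinfun_compose)
  then have "cinner (T x) (T x) = 0"
    using cinner_eq_zero_iff[of "0 :: 'a"] cinner_diff_right[of x x x]
    by (simp add: cinner_op_adj[OF T])
  then show "T x = blinfun_apply 0 x"
    by (simp add: cinner_eq_zero_iff)
qed

section \<open>Closed subspaces and closed spans of products\<close>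

lemma scaleC_blinfun_apply: "blinfun_apply (c *\<^sub>C T) x = c *\<^sub>C blinfun_apply T x"
  by (simp add: scaleC_blinfun.rep_eq)

lemma scaleC_compose_left: "(c *\<^sub>C S) o\<^sub>L T = c *\<^sub>C (S o\<^sub>L T)"
  by (rule blinfun_eqI) (simp add: scaleC_blinfun_apply)

lemma scaleC_compose_right: "S \<in> bounded_ops \<Longrightarrow> S o\<^sub>L (c *\<^sub>C T) = c *\<^sub>C (S o\<^sub>L T)"
  by (rule blinfun_eqI) (simp add: scaleC_blinfun_apply bounded_ops_scaleC)

lemma continuous_on_compose_left: "continuous_on X (\<lambda>T. S o\<^sub>L T)"
  by (intro continuous_intros)

lemma continuous_on_compose_right: "continuous_on X (\<lambda>T. T o\<^sub>L S)"
  by (intro continuous_intros)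

lemma continuous_on_scaleC:
  "continuous_on X (\<lambda>T :: 'a :: real_normed_vector \<Rightarrow>\<^sub>L 'b :: complex_normed_vector. c *\<^sub>C T)"
proof -
  have "(\<lambda>T :: 'a \<Rightarrow>\<^sub>L 'b. c *\<^sub>C T) = (\<lambda>T. (c *\<^sub>C id_blinfun) o\<^sub>L T)"
    by (intro ext blinfun_eqI) (simp add: scaleC_blinfun_apply)
  then show ?thesis
    by (simp add: continuous_on_compose_left)
qed

lemma closure_imageI:
  assumes "continuous_on UNIV f" "x \<in> closure S" "\<And>y. y \<in> S \<Longrightarrow> f y \<in> closure T"
  shows "f x \<in> closure T"
  using image_closure_subset[of S f "closure T"] assms continuous_on_subset[OF assms(1)] by auto

lemma subspace_closure:
  fixes X :: "('a :: chilbert_space \<Rightarrow>\<^sub>L 'a) set"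
  assumes X: "complex_vector.subspace X"
  shows "complex_vector.subspace (closure X)"
proof (rule complex_vector.subspaceI)
  show "0 \<in> closure X"
    using complex_vector.subspace_0[OF X] closure_subset by blast
  show "x + y \<in> closure X" if "x \<in> closure X" "y \<in> closure X" for x y
  proof (rule closure_imageI[OF _ that(1)])
    show "z + y \<in> closure X" if "z \<in> X" for z
      by (rule closure_imageI[OF _ \<open>y \<in> closure X\<close>])
        (auto intro!: continuous_intros subsetD[OF closure_subset] complex_vector.subspace_add X that)
  qed (intro continuous_intros)
  show "c *\<^sub>C x \<in> closure X" if "x \<in> closure X" for c x
    by (rule closure_imageI[OF continuous_on_scaleC that])
      (intro subsetD[OF closure_subset] complex_vector.subspace_scale X)
qed

lemma closed_bounded_ops: "closed (bounded_ops :: ('a :: chilbert_space \<Rightarrow>\<^sub>L 'a) set)"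
proof -
  have "bounded_ops = (\<Inter>c. {T :: 'a \<Rightarrow>\<^sub>L 'a. T o\<^sub>L (c *\<^sub>C id_blinfun) = c *\<^sub>C T})"
    by (auto simp: bounded_ops_def scaleC_blinfun_apply fun_eq_iff simp flip: blinfun_apply_inject)
  moreover have "closed {T :: 'a \<Rightarrow>\<^sub>L 'a. T o\<^sub>L (c *\<^sub>C id_blinfun) = c *\<^sub>C T}" for c
    by (intro closed_Collect_eq continuous_on_compose_right continuous_on_scaleC)
  ultimately show ?thesis
    using closed_INT[of UNIV "\<lambda>c. {T :: 'a \<Rightarrow>\<^sub>L 'a. T o\<^sub>L (c *\<^sub>C id_blinfun) = c *\<^sub>C T}"] by metis
qed

lemma closed_csubspace_closure:
  assumes "complex_vector.subspace X" "X \<subseteq> bounded_ops"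
  shows "closed_csubspace (closure X)"
  using assms by (simp add: closed_csubspace_def subspace_closure closure_minimal closed_bounded_ops)

lemma subspace_image_compose_left:
  assumes "complex_vector.subspace X" "S \<in> bounded_ops"
  shows "complex_vector.subspace ((\<lambda>T. S o\<^sub>L T) ` X)"
proof (rule complex_vector.subspaceI)
  show "0 \<in> (\<lambda>T. S o\<^sub>L T) ` X"
    using complex_vector.subspace_0[OF assms(1)] by (force simp: image_iff)
  show "a + b \<in> (\<lambda>T. S o\<^sub>L T) ` X" if ab: "a \<in> (\<lambda>T. S o\<^sub>L T) ` X" "b \<in> (\<lambda>T. S o\<^sub>L T) ` X" for a b
  proof -
    obtain p q where "p \<in> X" "q \<in> X" "a = S o\<^sub>L p" "b = S o\<^sub>L q"
      using ab by blast
    then show ?thesis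
      using complex_vector.subspace_add[OF assms(1)]
      by (intro image_eqI[where x = "p + q"])
        (auto simp: bounded_bilinear.add_right[OF bounded_bilinear_blinfun_compose])
  qed
  show "c *\<^sub>C a \<in> (\<lambda>T. S o\<^sub>L T) ` X" if "a \<in> (\<lambda>T. S o\<^sub>L T) ` X" for a c
    using that complex_vector.subspace_scale[OF assms(1)]
    by (auto simp: scaleC_compose_right[OF assms(2), symmetric])
qed

lemma op_prodI: "x \<in> X \<Longrightarrow> y \<in> Y \<Longrightarrow> x o\<^sub>L y \<in> X \<odot> Y"
  unfolding op_prod_def by (rule subsetD[OF closure_subset], rule complex_vector.span_base) blast

lemma op_prod_subspace: "complex_vector.subspace (X \<odot> Y)" "closed (X \<odot> Y)"
  unfolding op_prod_def by (simp_all add: subspace_closure complex_vector.subspace_span)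

lemma op_prod_least:
  assumes "complex_vector.subspace K" "closed K" "\<And>x y. x \<in> X \<Longrightarrow> y \<in> Y \<Longrightarrow> x o\<^sub>L y \<in> K"
  shows "X \<odot> Y \<subseteq> K"
  unfolding op_prod_def
  by (intro closure_minimal complex_vector.span_minimal assms(1,2)) (use assms(3) in blast)

lemma op_prod_mono: "X \<subseteq> X' \<Longrightarrow> Y \<subseteq> Y' \<Longrightarrow> X \<odot> Y \<subseteq> X' \<odot> Y'"
  by (intro op_prod_least op_prod_subspace op_prodI) auto

text \<open>
  Elements of \<open>X \<odot> Y\<close> need not be products, but for fixed \<open>z\<close> the \<open>t\<close> with \<open>t z \<in> K\<close> form a closed
  subspace, so products suffice.
\<close>

lemma op_prod3_least:
  assumes K: "complex_vector.subspace K" "closed K"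
    and prod: "\<And>x y z. x \<in> X \<Longrightarrow> y \<in> Y \<Longrightarrow> z \<in> Z \<Longrightarrow> x o\<^sub>L y o\<^sub>L z \<in> K"
  shows "X \<odot> Y \<odot> Z \<subseteq> K"
proof (rule op_prod_least[OF K])
  fix t z assume "t \<in> X \<odot> Y" "z \<in> Z"
  have "X \<odot> Y \<subseteq> (\<lambda>t. t o\<^sub>L z) -` K"
  proof (rule op_prod_least)
    show "complex_vector.subspace ((\<lambda>t. t o\<^sub>L z) -` K)"
      by (rule complex_vector.subspaceI)
        (simp_all add: complex_vector.subspace_0[OF K(1)] complex_vector.subspace_add[OF K(1)]
          complex_vector.subspace_scale[OF K(1)] scaleC_compose_left
          bounded_bilinear.add_left[OF bounded_bilinear_blinfun_compose])
    show "closed ((\<lambda>t. t o\<^sub>L z) -` K)"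
      by (rule continuous_closed_vimage[OF K(2)]) (intro continuous_intros)
  qed (use prod \<open>z \<in> Z\<close> in auto)
  with \<open>t \<in> X \<odot> Y\<close> show "t o\<^sub>L z \<in> K"
    by auto
qed

lemma tro_triple:
  assumes "tro M" "x \<in> M" "y \<in> M" "z \<in> M"
  shows "x o\<^sub>L op_adj y o\<^sub>L z \<in> M"
  using assms op_prodI[OF op_prodI[of x M "op_adj y" "op_adj ` M"] \<open>z \<in> M\<close>]
  by (auto simp: tro_def)

section \<open>Approximation of \<open>m\<close> by multiples of \<open>m m\<^sup>*\<close>\<close>

text \<open>
  The operator \<open>1 - t m m\<^sup>*\<close> is a contraction, so the norms of the iterates decrease in \<open>n\<close>. With
  \<open>v k = (1 - t m\<^sup>* m)\<^sup>k x\<close> they equal \<open>\<parallel>m (v k)\<parallel>\<close>, and \<open>t \<parallel>m (v k)\<parallel>\<^sup>2\<close> is at most the drop from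
  \<open>\<parallel>v k\<parallel>\<^sup>2\<close> to \<open>\<parallel>v (k + 1)\<parallel>\<^sup>2\<close>. Hence \<open>n\<close> times the last term is bounded by a telescoping sum.
\<close>

lemma norm_iterate_bound:
  fixes m :: "'a :: chilbert_space \<Rightarrow>\<^sub>L 'a"
  assumes m: "m \<in> bounded_ops" and t: "0 < t" "t * (norm m)\<^sup>2 \<le> 1"
  shows "real n * t * (norm ((((\<lambda>y. y - t *\<^sub>R m (op_adj m y)) ^^ n) (m x))))\<^sup>2 \<le> (norm x)\<^sup>2"
proof -
  have t_sq: "t\<^sup>2 * (norm (T y))\<^sup>2 \<le> t * (norm y)\<^sup>2" if "norm T \<le> norm m"
    for T :: "'a \<Rightarrow>\<^sub>L 'a" and y
  proof -
    have "norm (T y) \<le> norm m * norm y"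
      using norm_blinfun[of T y] mult_right_mono[OF that norm_ge_zero[of y]] by linarith
    then have "(norm (T y))\<^sup>2 \<le> (norm m)\<^sup>2 * (norm y)\<^sup>2"
      by (metis norm_ge_zero power_mono power_mult_distrib)
    then have "t\<^sup>2 * (norm (T y))\<^sup>2 \<le> t * ((t * (norm m)\<^sup>2) * (norm y)\<^sup>2)"
      using t(1) by (simp add: power2_eq_square mult.assoc)
    also have "\<dots> \<le> t * (1 * (norm y)\<^sup>2)"
      using t by (intro mult_left_mono mult_right_mono) auto
    finally show ?thesis
      by simp
  qed
  define v where "v k = ((\<lambda>y. y - t *\<^sub>R op_adj m (m y)) ^^ k) x" for k
  define y where "y k = ((\<lambda>y. y - t *\<^sub>R m (op_adj m y)) ^^ k) (m x)" for k
  have v_Suc: "v (Suc k) = v k - t *\<^sub>R op_adj m (m (v k))" for k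
    by (simp add: v_def)
  have y_Suc: "y (Suc k) = y k - t *\<^sub>R m (op_adj m (y k))" for k
    by (simp add: y_def)
  have y_eq: "y k = m (v k)" for k
  proof (induction k)
    case (Suc k)
    then show ?case
      by (simp add: y_Suc v_Suc blinfun.bilinear_simps)
  qed (simp add: v_def y_def)
  have drop: "t * (norm (y k))\<^sup>2 \<le> (norm (v k))\<^sup>2 - (norm (v (Suc k)))\<^sup>2" for k
    using t_sq[OF norm_op_adj_le[OF m], of "m (v k)"]
    by (simp add: v_Suc y_eq norm_sq_diff cinner_scaleR_right norm_sq_eq_cinner[of "m (v k)"]
        cinner_op_adj[OF m] power_mult_distrib)
  have decr: "(norm (y (Suc k)))\<^sup>2 \<le> (norm (y k))\<^sup>2" for k
  proof -
    let ?z = "op_adj m (y k)"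
    have "(norm (y (Suc k)))\<^sup>2 = (norm (y k))\<^sup>2 - 2 * (t * (norm ?z)\<^sup>2) + t\<^sup>2 * (norm (m ?z))\<^sup>2"
      by (simp add: y_Suc norm_sq_diff cinner_scaleR_right norm_sq_eq_cinner[of ?z]
          cinner_op_adj_left[OF m] power_mult_distrib)
    moreover have "0 \<le> t * (norm ?z)\<^sup>2"
      using t(1) by simp
    ultimately show ?thesis
      using t_sq[OF order_refl, of ?z] by linarith
  qed
  have "real n * t * (norm (y n))\<^sup>2 \<le> (norm (v 0))\<^sup>2 - (norm (v n))\<^sup>2" for n
  proof (induction n)
    case (Suc n)
    have "real (Suc n) * t * (norm (y (Suc n)))\<^sup>2 \<le> real (Suc n) * t * (norm (y n))\<^sup>2"
      using t(1) by (intro mult_left_mono decr) simp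
    also have "\<dots> = real n * t * (norm (y n))\<^sup>2 + t * (norm (y n))\<^sup>2"
      by (simp add: algebra_simps)
    finally show ?case
      using Suc drop[of n] by linarith
  qed simp
  from this[of n] have "real n * t * (norm (y n))\<^sup>2 \<le> (norm (v 0))\<^sup>2"
    using zero_le_power2[of "norm (v n)"] by linarith
  then show ?thesis
    by (simp add: v_def y_def)
qed

text \<open>
  The iterates \<open>w n = (1 - t m m\<^sup>*)\<^sup>n m\<close> stay in \<open>K\<close>, tend to \<open>0\<close>, and change in each step by an
  element of \<open>m m\<^sup>* K\<close>.
\<close>

lemma in_closure_square_multiples:
  fixes K :: "('a :: chilbert_space \<Rightarrow>\<^sub>L 'a) set"
  assumes K: "complex_vector.subspace K" and m: "m \<in> K" "m \<in> bounded_ops"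
    and closed_under: "\<And>z. z \<in> K \<Longrightarrow> m o\<^sub>L op_adj m o\<^sub>L z \<in> K"
  shows "m \<in> closure ((\<lambda>z. m o\<^sub>L op_adj m o\<^sub>L z) ` K)"
proof -
  let ?S = "(\<lambda>z. m o\<^sub>L op_adj m o\<^sub>L z) ` K"
  have S: "complex_vector.subspace ?S"
    by (intro subspace_image_compose_left K bounded_ops_compose op_adj_in m)
  have scaleR: "r *\<^sub>R z \<in> X" if "complex_vector.subspace X" "z \<in> X" for X r and z :: "'a \<Rightarrow>\<^sub>L 'a"
    using complex_vector.subspace_scale[OF that, of "of_real r"] by (simp add: scaleC_of_real)
  define t where "t = 1 / (1 + (norm m)\<^sup>2)"
  have t: "0 < t" "t * (norm m)\<^sup>2 \<le> 1"
    by (simp_all add: t_def add_pos_nonneg)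
  define w where "w n = ((\<lambda>z. z - t *\<^sub>R (m o\<^sub>L op_adj m o\<^sub>L z)) ^^ n) m" for n
  have w_Suc: "w (Suc n) = w n - t *\<^sub>R (m o\<^sub>L op_adj m o\<^sub>L w n)" for n
    by (simp add: w_def)
  have w_K: "w n \<in> K" for n
  proof (induction n)
    case (Suc n)
    then show ?case
      unfolding w_Suc by (intro complex_vector.subspace_diff K scaleR closed_under)
  qed (simp add: w_def m)
  have diff: "m - w n \<in> ?S" for n
  proof (induction n)
    case 0
    then show ?case
      using complex_vector.subspace_0[OF S] by (simp add: w_def)
  next
    case (Suc n)
    have "m - w (Suc n) = (m - w n) + t *\<^sub>R (m o\<^sub>L op_adj m o\<^sub>L w n)"
      by (simp add: w_Suc)
    also have "\<dots> \<in> ?S"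
      by (intro complex_vector.subspace_add S Suc scaleR imageI w_K)
    finally show ?case .
  qed
  have w_apply: "w n x = ((\<lambda>y. y - t *\<^sub>R m (op_adj m y)) ^^ n) (m x)" for n x
  proof (induction n)
    case (Suc n)
    then show ?case
      by (simp add: w_Suc blinfun.bilinear_simps)
  qed (simp add: w_def)
  have norm_w: "norm (w n) \<le> sqrt (1 / (real n * t))" if "n > 0" for n
  proof (rule norm_blinfun_bound)
    fix x
    have nt: "0 < real n * t"
      using that t by simp
    have "real n * t * (norm (w n x))\<^sup>2 \<le> (norm x)\<^sup>2"
      using norm_iterate_bound[OF m(2) t, of n x] by (simp add: w_apply)
    then have "(norm (w n x))\<^sup>2 \<le> 1 / (real n * t) * (norm x)\<^sup>2"
      using nt by (simp add: field_simps)
    then have "sqrt ((norm (w n x))\<^sup>2) \<le> sqrt (1 / (real n * t) * (norm x)\<^sup>2)"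
      by (rule real_sqrt_le_mono)
    then show "norm (w n x) \<le> sqrt (1 / (real n * t)) * norm x"
      by (simp only: real_sqrt_mult real_sqrt_abs abs_norm_cancel)
  qed (use t in simp)
  have "(\<lambda>n. sqrt (1 / t * (1 / real n))) \<longlonglongrightarrow> sqrt (1 / t * 0)"
    by (intro tendsto_intros lim_1_over_n)
  then have "(\<lambda>n. sqrt (1 / (real n * t))) \<longlonglongrightarrow> 0"
    by (simp add: mult.commute)
  then have "w \<longlonglongrightarrow> 0"
    by (rule Lim_null_comparison[rotated]) (rule eventually_sequentiallyI[of 1], rule norm_w, simp)
  then have "(\<lambda>n. m - w n) \<longlonglongrightarrow> m - 0"
    by (intro tendsto_intros)
  then show ?thesis
    unfolding closure_sequential using diff by (intro exI[of _ "\<lambda>n. m - w n"]) simp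
qed

section \<open>Ternary rings with commuting products\<close>

locale commutative_tro =
  fixes M :: "('a :: chilbert_space \<Rightarrow>\<^sub>L 'a) set"
  assumes tro: "tro M"
    and left_commute: "\<lbrakk>x \<in> M; y \<in> M; z \<in> M; w \<in> M\<rbrakk> \<Longrightarrow>
      (x o\<^sub>L op_adj y) o\<^sub>L (z o\<^sub>L op_adj w) = (z o\<^sub>L op_adj w) o\<^sub>L (x o\<^sub>L op_adj y)"
    and right_commute: "\<lbrakk>x \<in> M; y \<in> M; z \<in> M; w \<in> M\<rbrakk> \<Longrightarrow>
      (op_adj x o\<^sub>L y) o\<^sub>L (op_adj z o\<^sub>L w) = (op_adj z o\<^sub>L w) o\<^sub>L (op_adj x o\<^sub>L y)"
begin

lemma subspace: "complex_vector.subspace M" and closed: "closed M" and ops: "x \<in> M \<Longrightarrow> x \<in> bounded_ops"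
  using tro by (auto simp: tro_def closed_csubspace_def)

lemmas triple = tro_triple[OF tro]

text \<open>
  Let \<open>D\<close> be the difference of the two sides. Commuting \<open>x y\<^sup>*\<close> with \<open>z y\<^sup>*\<close> gives \<open>D y\<^sup>* = 0\<close>.
  Commuting \<open>D\<^sup>* x\<close> with \<open>y\<^sup>* z\<close>, and \<open>D\<^sup>* z\<close> with \<open>y\<^sup>* x\<close>, brings \<open>y\<^sup>*\<close> to the left in
  \<open>D\<^sup>* D\<close>, so that \<open>D D\<^sup>* D = 0\<close>. Then \<open>D\<^sup>* D\<close> is self-adjoint with square \<open>0\<close>, and \<open>D = 0\<close>.
\<close>

lemma triple_symmetric:
  assumes x: "x \<in> M" and y: "y \<in> M" and z: "z \<in> M"
  shows "x o\<^sub>L op_adj y o\<^sub>L z = z o\<^sub>L op_adj y o\<^sub>L x"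
proof -
  note diff_left = bounded_bilinear.diff_left[OF bounded_bilinear_blinfun_compose]
  note diff_right = bounded_bilinear.diff_right[OF bounded_bilinear_blinfun_compose]
  define D where "D = (x o\<^sub>L op_adj y o\<^sub>L z) - (z o\<^sub>L op_adj y o\<^sub>L x)"
  have D: "D \<in> M"
    unfolding D_def by (intro complex_vector.subspace_diff subspace triple x y z)
  have Dy: "D o\<^sub>L op_adj y = 0"
    using left_commute[OF x y z y] by (simp add: D_def diff_left blinfun_compose_assoc)
  have "op_adj D o\<^sub>L D = op_adj D o\<^sub>L ((x o\<^sub>L op_adj y o\<^sub>L z) - (z o\<^sub>L op_adj y o\<^sub>L x))"
    by (simp only: D_def)
  also have "\<dots> = ((op_adj D o\<^sub>L x) o\<^sub>L (op_adj y o\<^sub>L z)) - ((op_adj D o\<^sub>L z) o\<^sub>L (op_adj y o\<^sub>L x))"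
    by (simp add: diff_right blinfun_compose_assoc)
  also have "\<dots> = op_adj y o\<^sub>L ((z o\<^sub>L op_adj D o\<^sub>L x) - (x o\<^sub>L op_adj D o\<^sub>L z))"
    unfolding right_commute[OF D x y z] right_commute[OF D z y x]
    by (simp add: diff_right blinfun_compose_assoc)
  finally have "D o\<^sub>L (op_adj D o\<^sub>L D) = (D o\<^sub>L op_adj y) o\<^sub>L ((z o\<^sub>L op_adj D o\<^sub>L x) - (x o\<^sub>L op_adj D o\<^sub>L z))"
    by (simp add: blinfun_compose_assoc)
  then have DDD: "D o\<^sub>L (op_adj D o\<^sub>L D) = 0"
    by (simp add: Dy)
  have DD: "op_adj D o\<^sub>L D \<in> bounded_ops"
    by (intro bounded_ops_compose op_adj_in ops D)
  have "op_adj (op_adj D o\<^sub>L D) o\<^sub>L (op_adj D o\<^sub>L D) = op_adj D o\<^sub>L (D o\<^sub>L (op_adj D o\<^sub>L D))"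
    by (simp add: op_adj_compose op_adj_in op_adj_op_adj ops D blinfun_compose_assoc)
  also have "\<dots> = 0"
    by (simp add: DDD)
  finally have "op_adj D o\<^sub>L D = 0"
    by (rule op_adj_compose_self_eq_0[OF DD])
  then have "D = 0"
    by (rule op_adj_compose_self_eq_0[OF ops[OF D]])
  then show ?thesis
    by (simp add: D_def)
qed

text \<open>In the line bundle picture, these are the sections supported where \<open>m\<close> does not vanish.\<close>

definition principal_ideal :: "('a \<Rightarrow>\<^sub>L 'a) \<Rightarrow> ('a \<Rightarrow>\<^sub>L 'a) set" where
  "principal_ideal m = closure ((\<lambda>z. m o\<^sub>L op_adj m o\<^sub>L z) ` M)"

context
  fixes m
  assumes m: "m \<in> M"
begin

lemma closed_csubspace_principal_ideal: "closed_csubspace (principal_ideal m)"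
  unfolding principal_ideal_def
  by (intro closed_csubspace_closure subspace_image_compose_left subspace bounded_ops_compose
      op_adj_in ops m) (auto intro: ops triple m)

lemma subspace_principal_ideal: "complex_vector.subspace (principal_ideal m)"
  and closed_principal_ideal: "closed (principal_ideal m)"
  using closed_csubspace_principal_ideal by (auto simp: closed_csubspace_def)

lemma principal_ideal_subset: "principal_ideal m \<subseteq> M"
  unfolding principal_ideal_def by (intro closure_minimal closed) (auto intro: triple m)

lemma principal_ideal_right:
  assumes "n \<in> principal_ideal m" "a \<in> M" "b \<in> M"
  shows "n o\<^sub>L op_adj a o\<^sub>L b \<in> principal_ideal m"
  using assms(1) unfolding principal_ideal_def
proof (rule closure_imageI[rotated])
  fix n assume "n \<in> (\<lambda>z. m o\<^sub>L op_adj m o\<^sub>L z) ` M"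
  then obtain z where z: "z \<in> M" "n = m o\<^sub>L op_adj m o\<^sub>L z"
    by blast
  then have eq: "n o\<^sub>L op_adj a o\<^sub>L b = m o\<^sub>L op_adj m o\<^sub>L (z o\<^sub>L op_adj a o\<^sub>L b)"
    by (simp add: blinfun_compose_assoc)
  show "n o\<^sub>L op_adj a o\<^sub>L b \<in> closure ((\<lambda>z. m o\<^sub>L op_adj m o\<^sub>L z) ` M)"
    unfolding eq by (intro subsetD[OF closure_subset] imageI triple z(1) assms(2,3))
qed (intro continuous_intros)

lemma principal_ideal_left:
  assumes "a \<in> M" "b \<in> M" "n \<in> principal_ideal m"
  shows "a o\<^sub>L op_adj b o\<^sub>L n \<in> principal_ideal m"
  using principal_ideal_right[OF assms(3,2,1)] triple_symmetric[of a b n] assms principal_ideal_subset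
  by auto

lemma generator_in_principal_ideal: "m \<in> principal_ideal m"
  unfolding principal_ideal_def
  by (rule in_closure_square_multiples) (auto intro: subspace ops triple m)

lemma tro_ideal_principal_ideal: "tro_ideal (principal_ideal m) M"
  unfolding tro_ideal_def
proof (intro conjI closed_csubspace_principal_ideal principal_ideal_subset)
  show "principal_ideal m \<odot> op_adj ` M \<odot> M \<subseteq> principal_ideal m"
    by (rule op_prod3_least[OF subspace_principal_ideal closed_principal_ideal])
      (auto intro: principal_ideal_right)
  show "M \<odot> op_adj ` M \<odot> principal_ideal m \<subseteq> principal_ideal m"
    by (rule op_prod3_least[OF subspace_principal_ideal closed_principal_ideal])
      (auto intro: principal_ideal_left)
qed

lemma tro_principal_ideal: "tro (principal_ideal m)"
  unfolding tro_def
proof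
  show "principal_ideal m \<odot> op_adj ` principal_ideal m \<odot> principal_ideal m \<subseteq> principal_ideal m"
    by (rule op_prod3_least[OF subspace_principal_ideal closed_principal_ideal])
      (auto intro: principal_ideal_right subsetD[OF principal_ideal_subset])
qed (rule closed_csubspace_principal_ideal)

text \<open>
  Since \<open>m\<close> is a limit of elements \<open>m m\<^sup>* n\<close> with \<open>n\<close> in the ideal, \<open>m m\<^sup>* z\<close> is a limit of the
  elements \<open>(m m\<^sup>* n) m\<^sup>* z = m m\<^sup>* (n m\<^sup>* z)\<close>, where \<open>n m\<^sup>* z\<close> is again in the ideal.
\<close>

lemma principal_ideal_eq_closure:
  "principal_ideal m = closure ((\<lambda>n. m o\<^sub>L op_adj m o\<^sub>L n) ` principal_ideal m)" (is "_ = closure ?S")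
proof
  show "closure ?S \<subseteq> principal_ideal m"
    by (intro closure_minimal closed_principal_ideal) (auto intro: principal_ideal_left m)
  have m_S: "m \<in> closure ?S"
    by (rule in_closure_square_multiples)
      (auto intro: subspace_principal_ideal generator_in_principal_ideal ops principal_ideal_left m)
  have "m o\<^sub>L op_adj m o\<^sub>L z \<in> closure ?S" if "z \<in> M" for z
  proof (rule closure_imageI[OF _ m_S, where f = "\<lambda>s. s o\<^sub>L op_adj m o\<^sub>L z"])
    fix s assume "s \<in> ?S"
    then obtain n where n: "n \<in> principal_ideal m" "s = m o\<^sub>L op_adj m o\<^sub>L n"
      by blast
    then have eq: "s o\<^sub>L op_adj m o\<^sub>L z = m o\<^sub>L op_adj m o\<^sub>L (n o\<^sub>L op_adj m o\<^sub>L z)"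
      by (simp add: blinfun_compose_assoc)
    show "s o\<^sub>L op_adj m o\<^sub>L z \<in> closure ?S"
      unfolding eq
      by (intro subsetD[OF closure_subset] imageI principal_ideal_right n(1) m that)
  qed (intro continuous_intros)
  then have "closure ((\<lambda>z. m o\<^sub>L op_adj m o\<^sub>L z) ` M) \<subseteq> closure ?S"
    by (intro closure_minimal) auto
  then show "principal_ideal m \<subseteq> closure ?S"
    by (subst principal_ideal_def)
qed

lemma closed_subspace_supset_principal_ideal:
  assumes "closed K" "\<And>n. n \<in> principal_ideal m \<Longrightarrow> m o\<^sub>L op_adj m o\<^sub>L n \<in> K"
  shows "principal_ideal m \<subseteq> K"
  using closure_minimal[of _ K] assms by (subst principal_ideal_eq_closure) blast

text \<open>
  By density it suffices to look at products with a factor \<open>m m\<^sup>* q\<close>. There the symmetry gives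
  \<open>p\<^sup>* (m m\<^sup>* q) = p\<^sup>* (q m\<^sup>* m) = (m q\<^sup>* p)\<^sup>* m\<close>, while regrouping alone gives
  \<open>(m m\<^sup>* q) p\<^sup>* = m (p q\<^sup>* m)\<^sup>*\<close>. For \<open>p\<close> and \<open>q\<close> in the ideal, both triple products in parentheses
  are in it as well, so one factor of each product has been moved to \<open>m\<close>.
\<close>

lemma regular_principal_ideal: "regular_tro (principal_ideal m)"
  unfolding regular_tro_def
proof (intro conjI bexI[of _ m])
  let ?N = "principal_ideal m"
  note N_M = subsetD[OF principal_ideal_subset]
  note m_N = generator_in_principal_ideal
  show "tro ?N"
    by (rule tro_principal_ideal)
  show "op_adj ` ?N \<odot> {m} = op_adj ` ?N \<odot> ?N"
  proof
    show "op_adj ` ?N \<odot> {m} \<subseteq> op_adj ` ?N \<odot> ?N"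
      using m_N by (intro op_prod_mono) auto
    show "op_adj ` ?N \<odot> ?N \<subseteq> op_adj ` ?N \<odot> {m}"
    proof (rule op_prod_least[OF op_prod_subspace])
      fix a n assume "a \<in> op_adj ` ?N" and n: "n \<in> ?N"
      then obtain p where p: "p \<in> ?N" "a = op_adj p"
        by blast
      have "?N \<subseteq> (\<lambda>n. op_adj p o\<^sub>L n) -` (op_adj ` ?N \<odot> {m})"
      proof (rule closed_subspace_supset_principal_ideal)
        show "closed ((\<lambda>n. op_adj p o\<^sub>L n) -` (op_adj ` ?N \<odot> {m}))"
          by (rule continuous_closed_vimage[OF op_prod_subspace(2)]) (intro continuous_intros)
        fix q assume q: "q \<in> ?N"
        have "op_adj p o\<^sub>L (m o\<^sub>L op_adj m o\<^sub>L q) = op_adj p o\<^sub>L (q o\<^sub>L op_adj m o\<^sub>L m)"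
          using triple_symmetric[OF m m N_M[OF q]] by simp
        also have "\<dots> = op_adj (m o\<^sub>L op_adj q o\<^sub>L p) o\<^sub>L m"
          unfolding op_adj_triple[OF ops[OF m] ops[OF N_M[OF q]] ops[OF N_M[OF p(1)]]]
          by (simp add: blinfun_compose_assoc)
        also have "\<dots> \<in> op_adj ` ?N \<odot> {m}"
          using principal_ideal_left[OF m N_M[OF q] p(1)] by (intro op_prodI) auto
        finally show "m o\<^sub>L op_adj m o\<^sub>L q \<in> (\<lambda>n. op_adj p o\<^sub>L n) -` (op_adj ` ?N \<odot> {m})"
          by simp
      qed
      with n p show "a o\<^sub>L n \<in> op_adj ` ?N \<odot> {m}"
        by auto
    qed
  qed
  show "{m} \<odot> op_adj ` ?N = ?N \<odot> op_adj ` ?N"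
  proof
    show "{m} \<odot> op_adj ` ?N \<subseteq> ?N \<odot> op_adj ` ?N"
      using m_N by (intro op_prod_mono) auto
    show "?N \<odot> op_adj ` ?N \<subseteq> {m} \<odot> op_adj ` ?N"
    proof (rule op_prod_least[OF op_prod_subspace])
      fix a n assume "a \<in> op_adj ` ?N" and n: "n \<in> ?N"
      then obtain p where p: "p \<in> ?N" "a = op_adj p"
        by blast
      have "?N \<subseteq> (\<lambda>n. n o\<^sub>L op_adj p) -` ({m} \<odot> op_adj ` ?N)"
      proof (rule closed_subspace_supset_principal_ideal)
        show "closed ((\<lambda>n. n o\<^sub>L op_adj p) -` ({m} \<odot> op_adj ` ?N))"
          by (rule continuous_closed_vimage[OF op_prod_subspace(2)]) (intro continuous_intros)
        fix q assume q: "q \<in> ?N"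
        have "(m o\<^sub>L op_adj m o\<^sub>L q) o\<^sub>L op_adj p = m o\<^sub>L op_adj (p o\<^sub>L op_adj q o\<^sub>L m)"
          unfolding op_adj_triple[OF ops[OF N_M[OF p(1)]] ops[OF N_M[OF q]] ops[OF m]]
          by (simp add: blinfun_compose_assoc)
        also have "\<dots> \<in> {m} \<odot> op_adj ` ?N"
          using principal_ideal_right[OF p(1) N_M[OF q] m] by (intro op_prodI) auto
        finally show "m o\<^sub>L op_adj m o\<^sub>L q \<in> (\<lambda>n. n o\<^sub>L op_adj p) -` ({m} \<odot> op_adj ` ?N)"
          by simp
      qed
      with n p show "n o\<^sub>L a \<in> {m} \<odot> op_adj ` ?N"
        by auto
    qed
  qed
  show "{m} \<odot> {op_adj m} \<odot> ?N = ?N"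
  proof
    show "{m} \<odot> {op_adj m} \<odot> ?N \<subseteq> ?N"
      by (rule op_prod3_least)
        (auto intro: subspace_principal_ideal closed_principal_ideal principal_ideal_left m)
    show "?N \<subseteq> {m} \<odot> {op_adj m} \<odot> ?N"
      by (intro closed_subspace_supset_principal_ideal op_prod_subspace op_prodI) auto
  qed
  show "?N \<odot> {op_adj m} \<odot> {m} = ?N"
  proof
    show "?N \<odot> {op_adj m} \<odot> {m} \<subseteq> ?N"
      by (rule op_prod3_least)
        (auto intro: subspace_principal_ideal closed_principal_ideal principal_ideal_right m)
    show "?N \<subseteq> ?N \<odot> {op_adj m} \<odot> {m}"
      by (intro closed_subspace_supset_principal_ideal op_prod_subspace)
        (simp add: triple_symmetric[OF m m N_M] op_prodI)
  qed
qed (rule ops[OF m])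

end

lemma locally_regular: "locally_regular M"
  unfolding locally_regular_def
proof (intro exI conjI ballI)
  let ?I = "principal_ideal ` M"
  show "tro_ideal (id N) M" "regular_tro (id N)" if "N \<in> ?I" for N
    using that by (auto intro: tro_ideal_principal_ideal regular_principal_ideal)
  show "M = closure (family_sum ?I id)"
  proof
    have "x \<in> family_sum ?I id" if "x \<in> M" for x
      unfolding family_sum_def using that generator_in_principal_ideal[OF that]
      by (auto intro!: exI[of _ "{principal_ideal x}"] exI[of _ "\<lambda>_. x"])
    then show "M \<subseteq> closure (family_sum ?I id)"
      using closure_subset by blast
    have "(\<Sum>i\<in>J. x i) \<in> M" if "J \<subseteq> ?I" "\<forall>i\<in>J. x i \<in> i" for J x
      using that principal_ideal_subset by (intro complex_vector.subspace_sum subspace) blast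
    then show "closure (family_sum ?I id) \<subseteq> M"
      by (intro closure_minimal closed) (auto simp: family_sum_def)
  qed
qed

end

theorem proposition2p9:
  fixes M :: "('a :: chilbert_space \<Rightarrow>\<^sub>L 'a) set"
  assumes "tro M"
    and "commutative_cstar_algebra (M \<odot> op_adj ` M)"
    and "commutative_cstar_algebra (op_adj ` M \<odot> M)"
  shows "locally_regular M"
proof -
  interpret commutative_tro M
  proof
    fix x y z w assume "x \<in> M" "y \<in> M" "z \<in> M" "w \<in> M"
    then show "(x o\<^sub>L op_adj y) o\<^sub>L (z o\<^sub>L op_adj w) = (z o\<^sub>L op_adj w) o\<^sub>L (x o\<^sub>L op_adj y)"
      and "(op_adj x o\<^sub>L y) o\<^sub>L (op_adj z o\<^sub>L w) = (op_adj z o\<^sub>L w) o\<^sub>L (op_adj x o\<^sub>L y)"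
      using assms(2,3) by (simp_all add: commutative_cstar_algebra_def op_prodI)
  qed (rule assms(1))
  show ?thesis
    by (rule locally_regular)
qed

end
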